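(* Let $\psi=\psi(s)$ be a unit speed curve in $\mathbb{E}^3$ with curvature $\kappa=\kappa(s)$ and torsion $\tau=\tau(s)$. Then the position vector $\psi$ satisfies the fourth-order vector differential equation $$ \frac{d}{ds}\left[\frac{1}{\tau}\frac{d}{ds}\left(\frac{1}{\kappa}\frac{d^2\psi}{ds^2}\right)\right]+\left(\frac{\kappa}{\tau}+\frac{\tau}{\kappa}\right)\frac{d^2\psi}{ds^2}+\frac{d}{ds}\left(\frac{\kappa}{\tau}\right)\frac{d\psi}{ds}=0. $$
   Context: $\mathbb{E}^3$ is Euclidean 3-space with its usual metric $dx_1^2+dx_2^2+dx_3^2$. A curve $\psi:I\subset\mathbb{R}\to\mathbb{E}^3$ is of unit speed (parameterized by arc-length $s$) if $\langle\psi'(s),\psi'(s)\rangle=1$ for all $s\in I$. The moving frame $\{\mathbf{T},\mathbf{N},\mathbf{B}\}$ along $\psi$ (tangent $\mathbf{T}=\psi'$, principal normal, binormal) consists of mutually orthogonal unit vectors, and the curvature $\kappa$ and torsion $\tau$ are the functions in the Frenet equations $\mathbf{T}'=\kappa\mathbf{N}$, $\mathbf{N}'=-\kappa\mathbf{T}+\tau\mathbf{B}$, $\mathbf{B}'=-\tau\mathbf{N}$, where $'=d/ds$. *)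

theory Defs
  imports "HOL-Analysis.Analysis"
begin

text \<open>
  The operator \<open>d/ds\<close> on functions of a parameter \<open>s\<close> in an interval \<open>I\<close>. On an open interval it is
  the ordinary derivative; at an endpoint belonging to \<open>I\<close> it is the one-sided derivative.
\<close>

definition ds :: "real set \<Rightarrow> (real \<Rightarrow> 'a::real_normed_vector) \<Rightarrow> real \<Rightarrow> 'a" where
  "ds I f s = vector_derivative f (at s within I)"

definition times_differentiable_on ::
    "nat \<Rightarrow> (real \<Rightarrow> 'a::real_normed_vector) \<Rightarrow> real set \<Rightarrow> bool" where
  "times_differentiable_on n f I \<longleftrightarrow> (\<forall>k<n. (ds I ^^ k) f differentiable_on I)"

definition unit_speed_on :: "real set \<Rightarrow> (real \<Rightarrow> real ^ 3) \<Rightarrow> bool" where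
  "unit_speed_on I \<psi> \<longleftrightarrow> (\<forall>s\<in>I. ds I \<psi> s \<bullet> ds I \<psi> s = 1)"

text \<open>
  Neither the orientation of the frame nor the sign of \<open>\<kappa>\<close> is fixed, so the usual normalisation
  \<open>\<kappa> > 0\<close>, \<open>B = T \<times> N\<close> is one instance.
\<close>

definition frenet_apparatus ::
    "real set \<Rightarrow> (real \<Rightarrow> real ^ 3) \<Rightarrow> (real \<Rightarrow> real ^ 3) \<Rightarrow> (real \<Rightarrow> real ^ 3) \<Rightarrow> (real \<Rightarrow> real ^ 3) \<Rightarrow>
      (real \<Rightarrow> real) \<Rightarrow> (real \<Rightarrow> real) \<Rightarrow> bool" where
  "frenet_apparatus I \<psi> T N B \<kappa> \<tau> \<longleftrightarrow>
    (\<forall>s\<in>I.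
      T s = ds I \<psi> s \<and>
      norm (T s) = 1 \<and> norm (N s) = 1 \<and> norm (B s) = 1 \<and>
      T s \<bullet> N s = 0 \<and> T s \<bullet> B s = 0 \<and> N s \<bullet> B s = 0 \<and>
      (T has_vector_derivative \<kappa> s *\<^sub>R N s) (at s within I) \<and>
      (N has_vector_derivative - \<kappa> s *\<^sub>R T s + \<tau> s *\<^sub>R B s) (at s within I) \<and>
      (B has_vector_derivative - \<tau> s *\<^sub>R N s) (at s within I))"

end

theory Submission
  imports Defs
begin

text \<open>
  The equation is the Frenet system with the frame eliminated. By the first Frenet equation
  \<open>\<psi>'' = \<kappa> N\<close>, so \<open>\<psi>'' / \<kappa> = N\<close>, and the second one gives
  \<open>(1/\<tau>) N' = B - (\<kappa>/\<tau>) T\<close>. Differentiating once more,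
  \<open>((1/\<tau>) N')' = - (\<kappa>/\<tau> + \<tau>/\<kappa>) \<kappa> N - (\<kappa>/\<tau>)' T\<close>, where the first term is a multiple
  of \<open>\<psi>''\<close> and the second one of \<open>\<psi>'\<close>.

  The last differentiation requires \<open>\<kappa>/\<tau>\<close> to be differentiable, whereas the Frenet equations only
  contain the values of \<open>\<kappa>\<close> and \<open>\<tau>\<close>. Regularity is recovered from the curve:
  \<open>\<kappa> = \<psi>'' \<bullet> N\<close> and \<open>\<kappa> \<tau> = \<psi>''' \<bullet> B\<close>, and on the right only
  differentiable functions occur, because \<open>\<psi>\<close> is four times differentiable
  and \<open>N\<close> and \<open>B\<close> satisfy the Frenet equations (\<open>frenet_curvatures_differentiable\<close>).
\<close>

text \<open>
  One-sided derivatives at the endpoints are determined only because a nondegenerate interval has no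
  isolated points.
\<close>

lemma at_within_interval_neq_bot:
  fixes I :: "real set"
  assumes "is_interval I" "interior I \<noteq> {}" "s \<in> I"
  shows "at s within I \<noteq> bot"
proof -
  have "I \<noteq> {a}" for a
    using assms(2) by auto
  then have "s islimpt I"
    using connected_imp_perfect[of I s] assms(1,3) by (simp add: is_interval_connected_1)
  then show ?thesis
    by (simp add: trivial_limit_within)
qed

lemma ds_eqI:
  fixes f g :: "real \<Rightarrow> 'a::real_normed_vector"
  assumes "is_interval I" "interior I \<noteq> {}" "s \<in> I"
    and "(g has_vector_derivative d) (at s within I)"
    and "\<And>u. u \<in> I \<Longrightarrow> f u = g u"
  shows "ds I f s = d"
proof -
  have "(f has_vector_derivative d) (at s within I)"
    by (rule has_vector_derivative_transform[OF assms(3) _ assms(4)]) (simp add: assms(5))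
  then show ?thesis
    unfolding ds_def
    by (rule vector_derivative_within[OF at_within_interval_neq_bot[OF assms(1-3)]])
qed

lemma has_vector_derivative_ds:
  assumes "f differentiable_on I" "s \<in> I"
  shows "(f has_vector_derivative ds I f s) (at s within I)"
  using assms by (simp add: ds_def differentiable_on_def vector_derivative_works)

lemma times_differentiable_on_ds:
  assumes "times_differentiable_on n f I" "k < n"
  shows "(ds I ^^ k) f differentiable_on I"
  using assms by (simp add: times_differentiable_on_def)

lemma differentiable_on_cong:
  assumes "g differentiable_on I" "\<And>u. u \<in> I \<Longrightarrow> f u = g u"
  shows "f differentiable_on I"
  using assms unfolding differentiable_on_def
  by (metis differentiable_transform_within zero_less_one)

lemma differentiable_on_inner:
  fixes f g :: "real \<Rightarrow> 'a::real_inner"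
  assumes "f differentiable_on I" "g differentiable_on I"
  shows "(\<lambda>u. f u \<bullet> g u) differentiable_on I"
  using assms by (simp add: differentiable_on_def differentiable_inner)

lemma differentiable_on_divide:
  fixes f g :: "real \<Rightarrow> real"
  assumes "f differentiable_on I" "g differentiable_on I" "\<forall>u\<in>I. g u \<noteq> 0"
  shows "(\<lambda>u. f u / g u) differentiable_on I"
  using assms by (simp add: differentiable_on_def differentiable_divide)

lemma frenet_apparatusD:
  assumes "frenet_apparatus I \<psi> T N B \<kappa> \<tau>" "s \<in> I"
  shows "T s = ds I \<psi> s"
    and "N s \<bullet> N s = 1" "B s \<bullet> B s = 1"
    and "T s \<bullet> B s = 0" "N s \<bullet> B s = 0"
    and "(T has_vector_derivative \<kappa> s *\<^sub>R N s) (at s within I)"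
    and "(N has_vector_derivative - \<kappa> s *\<^sub>R T s + \<tau> s *\<^sub>R B s) (at s within I)"
    and "(B has_vector_derivative - \<tau> s *\<^sub>R N s) (at s within I)"
  using assms unfolding frenet_apparatus_def norm_eq_1 by blast+

lemma frenet_frame_differentiable:
  assumes "frenet_apparatus I \<psi> T N B \<kappa> \<tau>"
  shows "T differentiable_on I" "N differentiable_on I" "B differentiable_on I"
  using frenet_apparatusD(6-8)[OF assms] differentiableI_vector
  unfolding differentiable_on_def by blast+

lemma frenet_second_derivative:
  assumes "is_interval I" "interior I \<noteq> {}"
    and "frenet_apparatus I \<psi> T N B \<kappa> \<tau>" "s \<in> I"
  shows "ds I (ds I \<psi>) s = \<kappa> s *\<^sub>R N s"
  by (rule ds_eqI[OF assms(1,2,4) frenet_apparatusD(6)[OF assms(3,4)]])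
    (rule frenet_apparatusD(1)[OF assms(3), symmetric])

text \<open>
  The curvatures inherit regularity from the curve by projecting its derivatives onto the frame:
  \<open>\<psi>''' = \<kappa>' N + \<kappa> (- \<kappa> T + \<tau> B)\<close> has \<open>B\<close>-component \<open>\<kappa> \<tau>\<close>. The differentiability of
  \<open>\<kappa>\<close> comes first, since it is what allows \<open>\<kappa> N\<close> to be expanded by the product rule.
\<close>

lemma frenet_curvatures_differentiable:
  assumes I: "is_interval I" "interior I \<noteq> {}"
    and diff: "times_differentiable_on 4 \<psi> I"
    and fr: "frenet_apparatus I \<psi> T N B \<kappa> \<tau>"
    and \<kappa>: "\<forall>s\<in>I. \<kappa> s \<noteq> 0"
  shows "\<kappa> differentiable_on I" "\<tau> differentiable_on I"
proof -
  have d2: "ds I (ds I \<psi>) differentiable_on I"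
    using times_differentiable_on_ds[OF diff, of 2] by (simp add: numeral_2_eq_2)
  have d3: "ds I (ds I (ds I \<psi>)) differentiable_on I"
    using times_differentiable_on_ds[OF diff, of 3] by (simp add: numeral_3_eq_3)
  have "\<kappa> u = ds I (ds I \<psi>) u \<bullet> N u" if "u \<in> I" for u
    using frenet_second_derivative[OF I fr that] frenet_apparatusD(2)[OF fr that] by simp
  then show dk: "\<kappa> differentiable_on I"
    by (rule differentiable_on_cong
        [OF differentiable_on_inner[OF d2 frenet_frame_differentiable(2)[OF fr]]])
  have "\<tau> u = (ds I (ds I (ds I \<psi>)) u \<bullet> B u) / \<kappa> u" if u: "u \<in> I" for u
  proof -
    have "((\<lambda>u. \<kappa> u *\<^sub>R N u) has_vector_derivative
        \<kappa> u *\<^sub>R (- \<kappa> u *\<^sub>R T u + \<tau> u *\<^sub>R B u) + ds I \<kappa> u *\<^sub>R N u) (at u within I)"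
      using has_vector_derivative_ds[OF dk u] frenet_apparatusD(7)[OF fr u]
      by (intro has_vector_derivative_scaleR)
        (simp_all add: has_real_derivative_iff_has_vector_derivative)
    then have "ds I (ds I (ds I \<psi>)) u =
        \<kappa> u *\<^sub>R (- \<kappa> u *\<^sub>R T u + \<tau> u *\<^sub>R B u) + ds I \<kappa> u *\<^sub>R N u"
      by (rule ds_eqI[OF I u _ frenet_second_derivative[OF I fr]])
    then have "ds I (ds I (ds I \<psi>)) u \<bullet> B u = \<kappa> u * \<tau> u"
      using frenet_apparatusD(3-5)[OF fr u] by (simp add: inner_add_left inner_diff_left)
    then show ?thesis
      using \<kappa> u by simp
  qed
  then show "\<tau> differentiable_on I"
    by (rule differentiable_on_cong[OF differentiable_on_divide
        [OF differentiable_on_inner[OF d3 frenet_frame_differentiable(3)[OF fr]] dk \<kappa>]])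
qed

theorem theorem3p1:
  fixes I :: "real set"
    and \<psi> T N B :: "real \<Rightarrow> real ^ 3"
    and \<kappa> \<tau> :: "real \<Rightarrow> real"
  assumes "is_interval I" and "interior I \<noteq> {}"
    and "times_differentiable_on 4 \<psi> I"
    and "unit_speed_on I \<psi>"
    and "frenet_apparatus I \<psi> T N B \<kappa> \<tau>"
    and "\<forall>s\<in>I. \<kappa> s \<noteq> 0" and "\<forall>s\<in>I. \<tau> s \<noteq> 0"
  shows "(\<lambda>u. (1 / \<kappa> u) *\<^sub>R ds I (ds I \<psi>) u) differentiable_on I \<and>
    (\<lambda>u. (1 / \<tau> u) *\<^sub>R ds I (\<lambda>v. (1 / \<kappa> v) *\<^sub>R ds I (ds I \<psi>) v) u) differentiable_on I \<and>
    (\<lambda>u. \<kappa> u / \<tau> u) differentiable_on I \<and>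
    (\<forall>s\<in>I.
      ds I (\<lambda>u. (1 / \<tau> u) *\<^sub>R ds I (\<lambda>v. (1 / \<kappa> v) *\<^sub>R ds I (ds I \<psi>) v) u) s
      + (\<kappa> s / \<tau> s + \<tau> s / \<kappa> s) *\<^sub>R ds I (ds I \<psi>) s
      + ds I (\<lambda>u. \<kappa> u / \<tau> u) s *\<^sub>R ds I \<psi> s = 0)"
proof -
  note I = assms(1,2) and fr = assms(5) and \<kappa> = assms(6) and \<tau> = assms(7)
  let ?P = "\<lambda>u. (1 / \<kappa> u) *\<^sub>R ds I (ds I \<psi>) u"
  let ?Q = "\<lambda>u. (1 / \<tau> u) *\<^sub>R ds I ?P u"
  let ?q = "\<lambda>u. \<kappa> u / \<tau> u"
  let ?R = "\<lambda>u. B u - ?q u *\<^sub>R T u"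
  have P: "?P u = N u" if "u \<in> I" for u
    using frenet_second_derivative[OF I fr that] \<kappa> that by simp
  have dP: "ds I ?P u = - \<kappa> u *\<^sub>R T u + \<tau> u *\<^sub>R B u" if "u \<in> I" for u
    by (rule ds_eqI[OF I that frenet_apparatusD(7)[OF fr that] P])
  have Q: "?Q u = ?R u" if "u \<in> I" for u
    using dP[OF that] \<tau> that by (simp add: scaleR_add_right scaleR_diff_right)
  have q: "?q differentiable_on I"
    by (rule differentiable_on_divide
        [OF frenet_curvatures_differentiable[OF I assms(3) fr \<kappa>] \<tau>])
  have dR: "(?R has_vector_derivative
      - \<tau> s *\<^sub>R N s - (?q s *\<^sub>R (\<kappa> s *\<^sub>R N s) + ds I ?q s *\<^sub>R T s)) (at s within I)"
    if s: "s \<in> I" for s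
    using has_vector_derivative_ds[OF q s] frenet_apparatusD(6,8)[OF fr s]
    by (intro has_vector_derivative_diff has_vector_derivative_scaleR)
      (simp_all add: has_real_derivative_iff_has_vector_derivative)
  have "?R differentiable_on I"
    using dR differentiableI_vector unfolding differentiable_on_def by blast
  then have "?Q differentiable_on I"
    by (rule differentiable_on_cong[OF _ Q])
  moreover have "?P differentiable_on I"
    by (rule differentiable_on_cong[OF frenet_frame_differentiable(2)[OF fr] P])
  moreover have "ds I ?Q s + (\<kappa> s / \<tau> s + \<tau> s / \<kappa> s) *\<^sub>R ds I (ds I \<psi>) s
      + ds I ?q s *\<^sub>R ds I \<psi> s = 0" if s: "s \<in> I" for s
  proof -
    have "(\<kappa> s / \<tau> s + \<tau> s / \<kappa> s) *\<^sub>R ds I (ds I \<psi>) s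
        = ?q s *\<^sub>R (\<kappa> s *\<^sub>R N s) + \<tau> s *\<^sub>R N s"
      using frenet_second_derivative[OF I fr s] \<kappa> s by (simp add: distrib_right scaleR_add_left)
    then show ?thesis
      using ds_eqI[OF I s dR[OF s] Q] frenet_apparatusD(1)[OF fr s] by simp
  qed
  ultimately show ?thesis
    using q by blast
qed

end
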